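(* The set $I_L^{red}$ has $O(\frac{1}{\varepsilon}\log^2\frac{1}{\varepsilon})$ items. The following algorithm constructs $I_L^{red}$ in time $O(n+\frac{1}{\varepsilon}\log^2\frac{1}{\varepsilon})$ and space $O(\frac{1}{\varepsilon}\log^2\frac{1}{\varepsilon})$ (including the space for storing $I_L^{red}$): initialize an empty slot $a_{k,\gamma}$ for every $k\in\{0,\dots,\kappa\}$, $\gamma\in\{0,\dots,2^{\kappa+1}(\kappa+1)-1\}$ and for $(k,\gamma)=(\kappa+1,0)$; then for each $a\in I_L$ determine the pair $(k(a),\gamma(a))$ with $p(a)\in L_{k(a),\gamma(a)}$ and store $a$ in slot $a_{k(a),\gamma(a)}$ if that slot is empty or contains an item of larger size; output the set of stored items.
   Context: UKP instance $I$ with $n$ items, profits $p(a)\in(0,1]$, sizes $s(a)\in(0,1]$, capacity $c=1$. Let $\varepsilon=1/2^{\kappa-1}$ with $\kappa\in\mathbb{N}$, $\varepsilon\le1/4$. Let $a_{me}$ be an item of $I$ maximizing $p/s$, $P_0=p(a_{me})\lfloor c/s(a_{me})\rfloor$, $T=\frac12\varepsilon P_0$, $K=\frac14\cdot\frac{1}{\kappa+1}\varepsilon T$, and $I_L=\{a\in I: p(a)\ge T\}$. For $k\in\{0,\dots,\kappa\}$, $\gamma\in\{0,\dots,2^{\kappa+1}(\kappa+1)-1\}$ let $L_{k,\gamma}=[2^kT+\gamma2^kK,\ 2^kT+(\gamma+1)2^kK)$, and $L_{\kappa+1,0}=\{2P_0\}$; every profit of an item in $I_L$ lies in exactly one of these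 sets. $a_{k,\gamma}$ is an item of minimum size among items of $I_L$ with profit in $L_{k,\gamma}$ (if any), and $I_L^{red}$ is the set of all existing $a_{k,\gamma}$. Computational model: basic arithmetic operations and logarithms take $O(1)$ time. *)

theory Defs
  imports Complex_Main "HOL-Library.Monad_Syntax"
begin

section \<open>The knapsack instance and the reduced item set\<close>

text \<open>The items of an instance are the indices below \<open>n\<close>, so that distinct items may have
  the same profit and the same size. The capacity is 1.\<close>

definition ukp_instance :: "nat \<Rightarrow> (nat \<Rightarrow> real) \<Rightarrow> (nat \<Rightarrow> real) \<Rightarrow> bool" where
  "ukp_instance n p s \<longleftrightarrow> (\<forall>a<n. 0 < p a \<and> p a \<le> 1 \<and> 0 < s a \<and> s a \<le> 1)"

definition most_efficient :: "nat \<Rightarrow> (nat \<Rightarrow> real) \<Rightarrow> (nat \<Rightarrow> real) \<Rightarrow> nat \<Rightarrow> bool" where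
  "most_efficient n p s a \<longleftrightarrow> is_arg_max (\<lambda>b. p b / s b) (\<lambda>b. b < n) a"

definition P0_of :: "(nat \<Rightarrow> real) \<Rightarrow> (nat \<Rightarrow> real) \<Rightarrow> nat \<Rightarrow> real" where
  "P0_of p s a_me = p a_me * of_int \<lfloor>1 / s a_me\<rfloor>"

definition T_of :: "real \<Rightarrow> real \<Rightarrow> real" where
  "T_of \<epsilon> P0 = 1/2 * \<epsilon> * P0"

definition K_of :: "nat \<Rightarrow> real \<Rightarrow> real \<Rightarrow> real" where
  "K_of \<kappa> \<epsilon> P0 = 1/4 * (1 / (real \<kappa> + 1)) * \<epsilon> * T_of \<epsilon> P0"

definition large_items :: "nat \<Rightarrow> (nat \<Rightarrow> real) \<Rightarrow> real \<Rightarrow> real \<Rightarrow> nat set" where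
  "large_items n p \<epsilon> P0 = {a. a < n \<and> T_of \<epsilon> P0 \<le> p a}"

definition slots :: "nat \<Rightarrow> (nat \<times> nat) set" where
  "slots \<kappa> = {0..\<kappa>} \<times> {0..<2 ^ (\<kappa> + 1) * (\<kappa> + 1)} \<union> {(\<kappa> + 1, 0)}"

definition L_interval :: "nat \<Rightarrow> real \<Rightarrow> real \<Rightarrow> nat \<Rightarrow> nat \<Rightarrow> real set" where
  "L_interval \<kappa> \<epsilon> P0 k \<gamma> =
    (if (k, \<gamma>) = (\<kappa> + 1, 0) then {2 * P0}
     else {2 ^ k * T_of \<epsilon> P0 + real \<gamma> * 2 ^ k * K_of \<kappa> \<epsilon> P0
           ..< 2 ^ k * T_of \<epsilon> P0 + (real \<gamma> + 1) * 2 ^ k * K_of \<kappa> \<epsilon> P0})"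

definition profit_class ::
    "nat \<Rightarrow> (nat \<Rightarrow> real) \<Rightarrow> nat \<Rightarrow> real \<Rightarrow> real \<Rightarrow> nat \<Rightarrow> nat \<Rightarrow> nat set" where
  "profit_class n p \<kappa> \<epsilon> P0 k \<gamma> = {a \<in> large_items n p \<epsilon> P0. p a \<in> L_interval \<kappa> \<epsilon> P0 k \<gamma>}"

text \<open>Ties among the items of minimum size may be broken arbitrarily, so the reduced set is
  determined only up to the choice of the representatives \<open>rep k \<gamma>\<close>.\<close>

definition is_reduced_set ::
    "nat \<Rightarrow> (nat \<Rightarrow> real) \<Rightarrow> (nat \<Rightarrow> real) \<Rightarrow> nat \<Rightarrow> real \<Rightarrow> real \<Rightarrow> nat set \<Rightarrow> bool" where
  "is_reduced_set n p s \<kappa> \<epsilon> P0 R \<longleftrightarrow>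
    (\<exists>rep :: nat \<Rightarrow> nat \<Rightarrow> nat.
      (\<forall>(k, \<gamma>) \<in> slots \<kappa>. profit_class n p \<kappa> \<epsilon> P0 k \<gamma> \<noteq> {} \<longrightarrow>
         is_arg_min s (\<lambda>a. a \<in> profit_class n p \<kappa> \<epsilon> P0 k \<gamma>) (rep k \<gamma>)) \<and>
      R = {rep k \<gamma> | k \<gamma>. (k, \<gamma>) \<in> slots \<kappa> \<and> profit_class n p \<kappa> \<epsilon> P0 k \<gamma> \<noteq> {}})"


section \<open>A real RAM with unit-cost arithmetic and logarithms\<close>

text \<open>Memory cells hold real numbers and are addressed by an array name and an index; a scalar
  is the entry 0 of its array. The result \<open>None\<close> stands for a run-time error: access to an
  undefined cell, an address or loop bound that is not a natural number, division by zero,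
  logarithm of a nonpositive number.\<close>

type_synonym memory = "string \<times> nat \<Rightarrow> real option"

datatype exp =
    Num int
  | Get string exp
  | Inp string exp
  | Add exp exp (infixl "\<^bold>+" 65)
  | Sub exp exp (infixl "\<^bold>-" 65)
  | Mul exp exp (infixl "\<^bold>*" 70)
  | Div exp exp (infixl "\<^bold>'/" 70)
  | Floor exp
  | Log2 exp

datatype bexp =
    Less exp exp (infix "\<^bold><" 50)
  | Leq exp exp (infix "\<^bold>\<le>" 50)
  | Or bexp bexp (infixr "\<^bold>\<or>" 30)

datatype com =
    Skip
  | Put string exp exp
  | Output exp
  | Seq com com (infixr ";;" 20)
  | If bexp com com
  | For string exp com

abbreviation Var :: "string \<Rightarrow> exp" where "Var x \<equiv> Get x (Num 0)"
abbreviation Par :: "string \<Rightarrow> exp" where "Par x \<equiv> Inp x (Num 0)"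
abbreviation Assign :: "string \<Rightarrow> exp \<Rightarrow> com" (infix "::=" 25) where
  "x ::= e \<equiv> Put x (Num 0) e"

definition to_index :: "real \<Rightarrow> nat option" where
  "to_index v = (if v \<in> \<nat> then Some (nat \<lfloor>v\<rfloor>) else None)"

primrec eval :: "memory \<Rightarrow> memory \<Rightarrow> exp \<Rightarrow> real option" where
  "eval inp \<mu> (Num z) = Some (of_int z)"
| "eval inp \<mu> (Get x e) = do { v \<leftarrow> eval inp \<mu> e; i \<leftarrow> to_index v; \<mu> (x, i) }"
| "eval inp \<mu> (Inp x e) = do { v \<leftarrow> eval inp \<mu> e; i \<leftarrow> to_index v; inp (x, i) }"
| "eval inp \<mu> (e1 \<^bold>+ e2) = do { u \<leftarrow> eval inp \<mu> e1; v \<leftarrow> eval inp \<mu> e2; Some (u + v) }"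
| "eval inp \<mu> (e1 \<^bold>- e2) = do { u \<leftarrow> eval inp \<mu> e1; v \<leftarrow> eval inp \<mu> e2; Some (u - v) }"
| "eval inp \<mu> (e1 \<^bold>* e2) = do { u \<leftarrow> eval inp \<mu> e1; v \<leftarrow> eval inp \<mu> e2; Some (u * v) }"
| "eval inp \<mu> (e1 \<^bold>/ e2) = do { u \<leftarrow> eval inp \<mu> e1; v \<leftarrow> eval inp \<mu> e2;
                            if v = 0 then None else Some (u / v) }"
| "eval inp \<mu> (Floor e) = do { v \<leftarrow> eval inp \<mu> e; Some (of_int \<lfloor>v\<rfloor>) }"
| "eval inp \<mu> (Log2 e) = do { v \<leftarrow> eval inp \<mu> e; if v \<le> 0 then None else Some (log 2 v) }"

primrec beval :: "memory \<Rightarrow> memory \<Rightarrow> bexp \<Rightarrow> bool option" where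
  "beval inp \<mu> (e1 \<^bold>< e2) = do { u \<leftarrow> eval inp \<mu> e1; v \<leftarrow> eval inp \<mu> e2; Some (u < v) }"
| "beval inp \<mu> (e1 \<^bold>\<le> e2) = do { u \<leftarrow> eval inp \<mu> e1; v \<leftarrow> eval inp \<mu> e2; Some (u \<le> v) }"
| "beval inp \<mu> (b1 \<^bold>\<or> b2) = do { r \<leftarrow> beval inp \<mu> b1; if r then Some True else beval inp \<mu> b2 }"

text \<open>Every constant, memory access, operation and comparison takes one unit of time. A
  disjunction is evaluated lazily but always charged for both disjuncts.\<close>

primrec cost :: "exp \<Rightarrow> nat" where
  "cost (Num z) = 1"
| "cost (Get x e) = cost e + 1"
| "cost (Inp x e) = cost e + 1"
| "cost (e1 \<^bold>+ e2) = cost e1 + cost e2 + 1"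
| "cost (e1 \<^bold>- e2) = cost e1 + cost e2 + 1"
| "cost (e1 \<^bold>* e2) = cost e1 + cost e2 + 1"
| "cost (e1 \<^bold>/ e2) = cost e1 + cost e2 + 1"
| "cost (Floor e) = cost e + 1"
| "cost (Log2 e) = cost e + 1"

primrec bcost :: "bexp \<Rightarrow> nat" where
  "bcost (e1 \<^bold>< e2) = cost e1 + cost e2 + 1"
| "bcost (e1 \<^bold>\<le> e2) = cost e1 + cost e2 + 1"
| "bcost (b1 \<^bold>\<or> b2) = bcost b1 + bcost b2 + 1"

text \<open>Work memory together with the output produced so far.\<close>

type_synonym state = "memory \<times> real list"

primrec iterate :: "(nat \<Rightarrow> 's \<Rightarrow> ('s \<times> nat) option) \<Rightarrow> nat \<Rightarrow> 's \<Rightarrow> ('s \<times> nat) option" where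
  "iterate f 0 \<sigma> = Some (\<sigma>, 0)"
| "iterate f (Suc m) \<sigma> =
    do { (\<sigma>1, t1) \<leftarrow> iterate f m \<sigma>; (\<sigma>2, t2) \<leftarrow> f m \<sigma>1; Some (\<sigma>2, t1 + t2) }"

text \<open>\<open>exec inp c \<sigma>\<close> yields the final state and the running time. \<open>For x e c\<close> runs \<open>c\<close> for
  \<open>x = 0, 1, \<dots>\<close> below the value of \<open>e\<close>, which is computed once; each round costs two units
  for updating and testing the counter.\<close>

primrec exec :: "memory \<Rightarrow> com \<Rightarrow> state \<Rightarrow> (state \<times> nat) option" where
  "exec inp Skip \<sigma> = Some (\<sigma>, 1)"
| "exec inp (Put x e1 e2) \<sigma> = (case \<sigma> of (\<mu>, out) \<Rightarrow>
    do { v \<leftarrow> eval inp \<mu> e1; i \<leftarrow> to_index v; w \<leftarrow> eval inp \<mu> e2;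
         Some ((\<mu>((x, i) \<mapsto> w), out), cost e1 + cost e2 + 1) })"
| "exec inp (Output e) \<sigma> = (case \<sigma> of (\<mu>, out) \<Rightarrow>
    do { v \<leftarrow> eval inp \<mu> e; Some ((\<mu>, out @ [v]), cost e + 1) })"
| "exec inp (c1 ;; c2) \<sigma> =
    do { (\<sigma>1, t1) \<leftarrow> exec inp c1 \<sigma>; (\<sigma>2, t2) \<leftarrow> exec inp c2 \<sigma>1; Some (\<sigma>2, t1 + t2) }"
| "exec inp (If b c1 c2) \<sigma> = (case \<sigma> of (\<mu>, out) \<Rightarrow>
    do { r \<leftarrow> beval inp \<mu> b;
         (\<sigma>1, t) \<leftarrow> (if r then exec inp c1 \<sigma> else exec inp c2 \<sigma>);
         Some (\<sigma>1, bcost b + t + 1) })"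
| "exec inp (For x e c) \<sigma> = (case \<sigma> of (\<mu>, out) \<Rightarrow>
    do { v \<leftarrow> eval inp \<mu> e; m \<leftarrow> to_index v;
         (\<sigma>1, t) \<leftarrow> iterate (\<lambda>i (\<mu>', out').
            do { (\<sigma>', t') \<leftarrow> exec inp c (\<mu>'((x, 0) \<mapsto> real i), out'); Some (\<sigma>', t' + 2) }) m \<sigma>;
         Some (\<sigma>1, cost e + t + 1) })"

text \<open>Cells are never released and the program starts with no defined cell, so the final
  state determines the maximal space. The output is counted; the read-only input is not (it has
  \<open>n\<close> items, more than the space bound in general). Operands of expressions need only a number
  of registers bounded by the length of the program.\<close>

definition space :: "state \<Rightarrow> nat" where
  "space \<sigma> = card (dom (fst \<sigma>)) + length (snd \<sigma>)"


section \<open>The algorithm\<close>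

definition alg_input ::
    "nat \<Rightarrow> (nat \<Rightarrow> real) \<Rightarrow> (nat \<Rightarrow> real) \<Rightarrow> nat \<Rightarrow> real \<Rightarrow> real \<Rightarrow> memory" where
  "alg_input n p s \<kappa> \<epsilon> P0 = (\<lambda>(x, i).
     if x = ''p'' then (if i < n then Some (p i) else None)
     else if x = ''s'' then (if i < n then Some (s i) else None)
     else if i = 0
       then [''n'' \<mapsto> real n, ''kappa'' \<mapsto> real \<kappa>, ''eps'' \<mapsto> \<epsilon>, ''P0'' \<mapsto> P0] x
     else None)"

text \<open>Slot \<open>(k, \<gamma>)\<close> is the entry \<open>k * N + \<gamma>\<close> of the array \<open>slot\<close>, where
  \<open>N = 4 / \<epsilon> * (\<kappa> + 1) = 2 ^ (\<kappa> + 1) * (\<kappa> + 1)\<close>. It contains the index of an item,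
  or \<open>-1\<close> if it is empty.\<close>

abbreviation slot_index :: "exp \<Rightarrow> exp \<Rightarrow> exp" where
  "slot_index k g \<equiv> k \<^bold>* Var ''N'' \<^bold>+ g"

definition init_params :: com where
  "init_params =
     (''N'' ::= Num 4 \<^bold>/ Par ''eps'' \<^bold>* (Par ''kappa'' \<^bold>+ Num 1) ;;
      ''T'' ::= Num 1 \<^bold>/ Num 2 \<^bold>* Par ''eps'' \<^bold>* Par ''P0'' ;;
      ''K'' ::= Num 1 \<^bold>/ Num 4 \<^bold>* (Num 1 \<^bold>/ (Par ''kappa'' \<^bold>+ Num 1)) \<^bold>* Par ''eps'' \<^bold>* Var ''T'')"

text \<open>Exponentiation is not a unit-cost operation, so the powers of two are tabulated.\<close>

definition init_powers :: com where
  "init_powers =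
     (Put ''pow'' (Num 0) (Num 1) ;;
      For ''k'' (Par ''kappa'' \<^bold>+ Num 1)
        (Put ''pow'' (Var ''k'' \<^bold>+ Num 1) (Num 2 \<^bold>* Get ''pow'' (Var ''k''))))"

definition init_slots :: com where
  "init_slots =
     (For ''k'' (Par ''kappa'' \<^bold>+ Num 1)
        (For ''g'' (Var ''N'')
          (Put ''slot'' (slot_index (Var ''k'') (Var ''g'')) (Num (-1)))) ;;
      Put ''slot'' (slot_index (Par ''kappa'' \<^bold>+ Num 1) (Num 0)) (Num (-1)))"

text \<open>The pair of an item is given by \<open>k = \<lfloor>log 2 (p a / T)\<rfloor>\<close> and
  \<open>g = \<lfloor>(p a - 2 ^ k * T) / (2 ^ k * K)\<rfloor>\<close>, which also covers \<open>p a = 2 * P0\<close>.\<close>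

definition fill_slots :: com where
  "fill_slots =
     For ''a'' (Par ''n'')
       (If (Var ''T'' \<^bold>\<le> Inp ''p'' (Var ''a''))
         (''k'' ::= Floor (Log2 (Inp ''p'' (Var ''a'') \<^bold>/ Var ''T'')) ;;
          ''g'' ::= Floor ((Inp ''p'' (Var ''a'') \<^bold>- Get ''pow'' (Var ''k'') \<^bold>* Var ''T'')
                           \<^bold>/ (Get ''pow'' (Var ''k'') \<^bold>* Var ''K'')) ;;
          ''j'' ::= slot_index (Var ''k'') (Var ''g'') ;;
          If (Get ''slot'' (Var ''j'') \<^bold>< Num 0 \<^bold>\<or>
              Inp ''s'' (Var ''a'') \<^bold>< Inp ''s'' (Get ''slot'' (Var ''j'')))
            (Put ''slot'' (Var ''j'') (Var ''a''))
            Skip)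
         Skip)"

definition output_slot :: "exp \<Rightarrow> com" where
  "output_slot j = If (Num 0 \<^bold>\<le> Get ''slot'' j) (Output (Get ''slot'' j)) Skip"

definition output_slots :: com where
  "output_slots =
     (For ''k'' (Par ''kappa'' \<^bold>+ Num 1)
        (For ''g'' (Var ''N'') (output_slot (slot_index (Var ''k'') (Var ''g'')))) ;;
      output_slot (slot_index (Par ''kappa'' \<^bold>+ Num 1) (Num 0)))"

definition reduction_alg :: com where
  "reduction_alg = (init_params ;; init_powers ;; init_slots ;; fill_slots ;; output_slots)"

end

theory Submission
  imports Defs
begin

text \<open>Every large item has a profit in \<open>[T, 2 * P0)\<close>, and \<open>K = T / N\<close> for the number
  \<open>N = 2 ^ (\<kappa> + 1) * (\<kappa> + 1)\<close> of parts into which each dyadic interval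
  \<open>[2 ^ k * T, 2 ^ (k + 1) * T)\<close> is divided. Hence the two floors computed by the algorithm
  determine the class of the item, and the slot of a class always contains a smallest of its items
  met so far. There are \<open>(\<kappa> + 1) * N + 1 = O(1/\<epsilon> * log\<^sup>2 (1/\<epsilon>))\<close> slots,
  since \<open>\<kappa> + 1 \<le> 2 * log 2 (1/\<epsilon>)\<close>.\<close>

section \<open>Reasoning about programs with running time\<close>

text \<open>A total-correctness triple: the existential also excludes run-time errors. The time
  \<open>t\<close> is only an upper bound, so that costs may be rounded up to convenient
  constants.\<close>

definition runs ::
    "memory \<Rightarrow> com \<Rightarrow> state \<Rightarrow> nat \<Rightarrow> (memory \<Rightarrow> real list \<Rightarrow> bool) \<Rightarrow> bool" where
  "runs inp c \<sigma> t Q \<longleftrightarrow>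
    (\<exists>\<mu> out t'. exec inp c \<sigma> = Some ((\<mu>, out), t') \<and> t' \<le> t \<and> Q \<mu> out)"

lemma runs_mono:
  assumes "runs inp c \<sigma> t P" "\<And>\<mu> out. P \<mu> out \<Longrightarrow> Q \<mu> out" "t \<le> t'"
  shows "runs inp c \<sigma> t' Q"
  using assms unfolding runs_def by (meson le_trans)

lemma runs_Skip: "Q \<mu> out \<Longrightarrow> 1 \<le> t \<Longrightarrow> runs inp Skip (\<mu>, out) t Q"
  by (simp add: runs_def)

lemma runs_Put:
  assumes "eval inp \<mu> e1 = Some v" "to_index v = Some i" "eval inp \<mu> e2 = Some w"
    and "Q (\<mu>((x, i) \<mapsto> w)) out" "cost e1 + cost e2 + 1 \<le> t"
  shows "runs inp (Put x e1 e2) (\<mu>, out) t Q"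
  using assms by (simp add: runs_def)

lemma runs_Output:
  assumes "eval inp \<mu> e = Some v" "Q \<mu> (out @ [v])" "cost e + 1 \<le> t"
  shows "runs inp (Output e) (\<mu>, out) t Q"
  using assms by (simp add: runs_def)

lemma runs_Seq:
  assumes "runs inp c1 \<sigma> t1 P" "\<And>\<mu> out. P \<mu> out \<Longrightarrow> runs inp c2 (\<mu>, out) t2 Q" "t1 + t2 \<le> t"
  shows "runs inp (c1 ;; c2) \<sigma> t Q"
proof -
  obtain \<mu>1 out1 t1' where 1: "exec inp c1 \<sigma> = Some ((\<mu>1, out1), t1')" "t1' \<le> t1" "P \<mu>1 out1"
    using assms(1) by (auto simp: runs_def)
  obtain \<mu>2 out2 t2' where 2: "exec inp c2 (\<mu>1, out1) = Some ((\<mu>2, out2), t2')" "t2' \<le> t2"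
      "Q \<mu>2 out2"
    using assms(2)[OF 1(3)] by (auto simp: runs_def)
  show ?thesis
    using 1 2 assms(3) by (simp add: runs_def)
qed

text \<open>The value \<open>r\<close> of the test is a proposition, so each branch may assume the
  outcome of the comparison. Both branches share one time bound.\<close>

lemma runs_If:
  assumes "beval inp \<mu> b = Some r" "r \<Longrightarrow> runs inp c1 (\<mu>, out) t' Q"
    and "\<not> r \<Longrightarrow> runs inp c2 (\<mu>, out) t' Q" "bcost b + t' + 1 \<le> t"
  shows "runs inp (If b c1 c2) (\<mu>, out) t Q"
  using assms by (cases r) (fastforce simp: runs_def)+

lemma to_index_of_nat [simp]: "to_index (real i) = Some i"
  by (simp add: to_index_def)

lemma iterate_invariant:
  assumes "\<And>i \<sigma>. i < m \<Longrightarrow> I i \<sigma> \<Longrightarrow> \<exists>\<sigma>' t. f i \<sigma> = Some (\<sigma>', t) \<and> t \<le> B \<and> I (Suc i) \<sigma>'"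
    and "I 0 \<sigma>"
  shows "\<exists>\<sigma>' t. iterate f m \<sigma> = Some (\<sigma>', t) \<and> t \<le> m * B \<and> I m \<sigma>'"
  using assms
proof (induction m)
  case (Suc m)
  then obtain \<sigma>1 t1 where 1: "iterate f m \<sigma> = Some (\<sigma>1, t1)" "t1 \<le> m * B" "I m \<sigma>1"
    by (metis less_Suc_eq)
  obtain \<sigma>2 t2 where "f m \<sigma>1 = Some (\<sigma>2, t2)" "t2 \<le> B" "I (Suc m) \<sigma>2"
    using Suc.prems(1)[of m \<sigma>1] 1 by auto
  then show ?case
    using 1 by simp
qed simp

text \<open>The invariant \<open>I i\<close> holds before the counter is written, whereas the body
  starts after that write. The summand 2 in \<open>B + 2\<close> is the charge for the
  counter.\<close>

lemma runs_For:
  assumes "eval inp \<mu> e = Some (real m)" "I 0 \<mu> out"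
    and body: "\<And>i \<mu> out. i < m \<Longrightarrow> I i \<mu> out \<Longrightarrow>
      runs inp c (\<mu>((x, 0) \<mapsto> real i), out) B (I (Suc i))"
    and "\<And>\<mu> out. I m \<mu> out \<Longrightarrow> Q \<mu> out"
    and "cost e + m * (B + 2) + 1 \<le> t"
  shows "runs inp (For x e c) (\<mu>, out) t Q"
proof -
  let ?f = "\<lambda>i (\<mu>', out').
    do { (\<sigma>', t') \<leftarrow> exec inp c (\<mu>'((x, 0) \<mapsto> real i), out'); Some (\<sigma>', t' + 2) }"
  have "\<exists>\<sigma>' t. iterate ?f m (\<mu>, out) = Some (\<sigma>', t) \<and> t \<le> m * (B + 2) \<and> case_prod (I m) \<sigma>'"
  proof (rule iterate_invariant[where I = "\<lambda>i. case_prod (I i)"])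
    fix i and \<sigma> :: state
    assume i: "i < m" "case_prod (I i) \<sigma>"
    show "\<exists>\<sigma>' t. ?f i \<sigma> = Some (\<sigma>', t) \<and> t \<le> B + 2 \<and> case_prod (I (Suc i)) \<sigma>'"
      using body[of i "fst \<sigma>" "snd \<sigma>"] i by (fastforce simp: runs_def split: prod.splits)
  qed (use assms(2) in simp)
  then show ?thesis
    using assms(1,4,5) by (fastforce simp: runs_def)
qed


section \<open>The classes of the large items\<close>

text \<open>Links the logarithm evaluated by the program with the powers of two in
  \<open>L_interval\<close>.\<close>

lemma floor_log2_eq_iff:
  assumes "0 < x"
  shows "\<lfloor>log 2 x\<rfloor> = int k \<longleftrightarrow> 2 ^ k \<le> x \<and> x < 2 ^ (k + 1)"
  using floor_log_eq_powr_iff[OF assms, of 2 "int k"]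
  by (simp add: powr_realpow powr_add mult.commute)

text \<open>One update of a running minimum. The strict comparison keeps the old element in case of
  a tie, which is still minimal.\<close>

lemma is_arg_min_extend:
  fixes f :: "'a \<Rightarrow> 'b :: linorder"
  assumes "is_arg_min f P r" "\<And>b. Q b \<longleftrightarrow> P b \<or> b = a"
  shows "is_arg_min f Q (if f a < f r then a else r)"
  using assms by (auto simp: is_arg_min_linorder)

section \<open>Arithmetic of the parameters and the bound on the profits\<close>

locale knapsack =
  fixes n :: nat and p s :: "nat \<Rightarrow> real" and \<kappa> :: nat and \<epsilon> :: real and a_me :: nat and P0 :: real
  assumes inst: "ukp_instance n p s"
    and eps: "\<epsilon> = 1 / 2 ^ (\<kappa> - 1)" and eps_le: "\<epsilon> \<le> 1 / 4"
    and a_me: "most_efficient n p s a_me"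
    and P0: "P0 = P0_of p s a_me"
begin

abbreviation T where "T \<equiv> T_of \<epsilon> P0"
abbreviation K where "K \<equiv> K_of \<kappa> \<epsilon> P0"
abbreviation large where "large \<equiv> large_items n p \<epsilon> P0"

definition N :: nat where "N = 2 ^ (\<kappa> + 1) * (\<kappa> + 1)"

lemma N_pos: "0 < N"
  by (simp add: N_def)

text \<open>With truncated subtraction, \<kappa> = 0 and \<kappa> = 1 both give \<epsilon> = 1, and
  \<kappa> = 2 gives 1/2; all three exceed 1/4.\<close>

lemma kappa_ge: "3 \<le> \<kappa>"
proof (rule ccontr)
  assume "\<not> 3 \<le> \<kappa>"
  then have "\<kappa> - 1 \<le> 1" by simp
  then have "(2::real) ^ (\<kappa> - 1) \<le> 2 ^ 1" by (intro power_increasing) auto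
  then have "1 / 2 \<le> \<epsilon>" by (simp add: eps field_simps)
  with eps_le show False by simp
qed

lemma two_power_kappa: "2 ^ \<kappa> = 2 / \<epsilon>"
  using kappa_ge by (cases \<kappa>) (auto simp: eps)

lemma eps_pos: "0 < \<epsilon>"
  by (simp add: eps)

lemma N_eq: "real N = 4 / \<epsilon> * (real \<kappa> + 1)"
  by (simp add: N_def two_power_kappa add_divide_distrib algebra_simps)

lemma P0_pos: "0 < P0"
proof -
  have "0 < s a_me" "s a_me \<le> 1" "0 < p a_me"
    using a_me inst by (auto simp: most_efficient_def is_arg_max_def ukp_instance_def)
  then show ?thesis
    by (simp add: P0 P0_of_def)
qed

lemma T_pos: "0 < T"
  by (simp add: T_of_def eps_pos P0_pos)

lemma K_eq: "K = T / real N"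
  by (simp add: K_of_def N_eq field_simps)

text \<open>The dyadic intervals of the levels 0 to \<kappa> thus end exactly at the value
  \<open>2 * P0\<close> that forms the last class.\<close>

lemma two_power_T: "2 ^ (\<kappa> + 1) * T = 2 * P0"
  using eps_pos by (simp add: two_power_kappa T_of_def)

text \<open>The efficiency of \<open>b\<close> is at most that of \<open>a_me\<close> and
  \<open>s b\<close> is at most 1, so \<open>p b\<close> is at most \<open>p a_me / s a_me\<close>.
  Since x < floor x + 1 \<le> 2 * floor x for x \<ge> 1, this is below \<open>2 * P0\<close>.
  Strictness leaves the class (\<kappa> + 1, 0) empty.\<close>

lemma profit_less:
  assumes "b < n"
  shows "p b < 2 * P0"
proof -
  have me: "0 < s a_me" "s a_me \<le> 1" "0 < p a_me"
    using a_me inst by (auto simp: most_efficient_def is_arg_max_def ukp_instance_def)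
  have b: "0 < s b" "s b \<le> 1" "0 < p b"
    using assms inst by (auto simp: ukp_instance_def)
  have "p b / s b \<le> p a_me / s a_me"
    using a_me assms by (auto simp: most_efficient_def is_arg_max_linorder)
  then have "p b \<le> p a_me / s a_me * s b"
    using b by (simp add: field_simps)
  also have "\<dots> \<le> p a_me / s a_me"
    using me b by (intro mult_left_le) auto
  also have "\<dots> = p a_me * (1 / s a_me)"
    by simp
  also have "\<dots> < p a_me * (2 * of_int \<lfloor>1 / s a_me\<rfloor>)"
  proof -
    have "1 \<le> \<lfloor>1 / s a_me\<rfloor>" using me by simp
    then have "1 / s a_me < 2 * of_int \<lfloor>1 / s a_me\<rfloor>" by linarith
    then show ?thesis using me by (intro mult_strict_left_mono)
  qed
  finally show ?thesis
    by (simp add: P0 P0_of_def)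
qed

text \<open>\<open>level\<close> and \<open>offset\<close> are the two floors that
  \<open>fill_slots\<close> evaluates. For large items these floors are nonnegative, so
  \<open>nat\<close> loses nothing.\<close>

definition level :: "nat \<Rightarrow> nat" where
  "level b = nat \<lfloor>log 2 (p b / T)\<rfloor>"

definition offset :: "nat \<Rightarrow> nat" where
  "offset b = nat \<lfloor>(p b - 2 ^ level b * T) / (2 ^ level b * K)\<rfloor>"

definition index :: "nat \<Rightarrow> nat" where
  "index b = level b * N + offset b"

lemma level_bounds:
  assumes "b \<in> large"
  shows "\<lfloor>log 2 (p b / T)\<rfloor> = int (level b)" "level b \<le> \<kappa>"
    and "2 ^ level b * T \<le> p b" "p b < 2 ^ (level b + 1) * T"
proof -
  have b: "b < n" "T \<le> p b"
    using assms by (auto simp: large_items_def)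
  have "1 \<le> p b / T"
    using b T_pos by simp
  then have "0 \<le> \<lfloor>log 2 (p b / T)\<rfloor>"
    by simp
  then show *: "\<lfloor>log 2 (p b / T)\<rfloor> = int (level b)"
    by (simp add: level_def)
  have "2 ^ level b \<le> p b / T" "p b / T < 2 ^ (level b + 1)"
    using \<open>1 \<le> p b / T\<close> * floor_log2_eq_iff[of "p b / T" "level b"] by auto
  then show "2 ^ level b * T \<le> p b" "p b < 2 ^ (level b + 1) * T"
    using T_pos by (simp_all add: field_simps)
  \<comment> \<open>The profit bound \<open>2 * P0\<close> is the left end of level \<kappa> + 1, so
    this level is out of reach.\<close>
  then have "2 ^ level b * T < 2 ^ (\<kappa> + 1) * T"
    using profit_less[OF b(1)] two_power_T by linarith
  then have "(2::real) ^ level b < 2 ^ (\<kappa> + 1)"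
    using T_pos by (simp only: mult_less_cancel_right_pos)
  then show "level b \<le> \<kappa>"
    by (metis less_Suc_eq_le one_less_numeral_iff power_less_imp_less_exp semiring_norm(76)
        Suc_eq_plus1)
qed

text \<open>Above the left end of its level the profit exceeds by less than
  \<open>2 ^ level b * T\<close>, which is N parts of length \<open>2 ^ level b * K\<close>.\<close>

lemma offset_bounds:
  assumes "b \<in> large"
  shows "\<lfloor>(p b - 2 ^ level b * T) / (2 ^ level b * K)\<rfloor> = int (offset b)" "offset b < N"
proof -
  let ?x = "(p b - 2 ^ level b * T) / (2 ^ level b * K)"
  have K: "0 < 2 ^ level b * K"
    using T_pos N_pos by (simp add: K_eq)
  have "0 \<le> ?x"
    using level_bounds(3)[OF assms] K by simp
  then show *: "\<lfloor>?x\<rfloor> = int (offset b)"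
    by (simp add: offset_def)
  have "p b - 2 ^ level b * T < real N * (2 ^ level b * K)"
    using level_bounds(4)[OF assms] N_pos by (simp add: K_eq mult_ac)
  then have "?x < real N"
    using K by (simp add: pos_divide_less_eq)
  then have "\<lfloor>?x\<rfloor> < int N"
    by (simp add: floor_less_iff)
  then show "offset b < N"
    using * by simp
qed

text \<open>For \<gamma> < N the part lies inside the dyadic interval of level k, so membership
  forces \<open>k = level b\<close>. For this k, membership says that the floor defining
  \<open>offset b\<close> equals \<gamma>.\<close>

lemma in_L_interval_iff:
  assumes b: "b \<in> large" and "k \<le> \<kappa>" "\<gamma> < N"
  shows "p b \<in> L_interval \<kappa> \<epsilon> P0 k \<gamma> \<longleftrightarrow> k = level b \<and> \<gamma> = offset b"
proof -
  have K: "0 < 2 ^ k * K"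
    using T_pos N_pos by (simp add: K_eq)
  \<comment> \<open>The bound on k rules out the singleton case of
    \<open>L_interval\<close>.\<close>
  have L: "p b \<in> L_interval \<kappa> \<epsilon> P0 k \<gamma> \<longleftrightarrow>
      \<lfloor>(p b - 2 ^ k * T) / (2 ^ k * K)\<rfloor> = int \<gamma>"
    unfolding floor_eq_iff using assms K
    by (auto simp: L_interval_def pos_le_divide_eq pos_divide_less_eq algebra_simps)
  have "k = level b" if "p b \<in> L_interval \<kappa> \<epsilon> P0 k \<gamma>"
  proof -
    have "(real \<gamma> + 1) * (2 ^ k * K) \<le> real N * (2 ^ k * K)"
      using assms K by (intro mult_right_mono) auto
    also have "\<dots> = 2 ^ k * T"
      using N_pos by (simp add: K_eq)
    finally have 1: "p b < 2 ^ (k + 1) * T"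
      using that assms by (auto simp: L_interval_def algebra_simps split: if_splits)
    have "0 \<le> real \<gamma> * (2 ^ k * K)"
      using K by simp
    then have 2: "2 ^ k * T \<le> p b"
      using that assms unfolding L_interval_def by (auto simp: mult.assoc split: if_splits)
    have "0 < p b"
      using b T_pos by (auto simp: large_items_def)
    then have "\<lfloor>log 2 (p b / T)\<rfloor> = int k"
      using 1 2 T_pos by (subst floor_log2_eq_iff) (auto simp: field_simps)
    then show ?thesis
      using level_bounds(1)[OF b] by simp
  qed
  then show ?thesis
    using L offset_bounds(1)[OF b] by auto
qed

section \<open>Numbering of the slots by consecutive addresses\<close>

lemma mem_slots_iff: "(k, \<gamma>) \<in> slots \<kappa> \<longleftrightarrow> k \<le> \<kappa> \<and> \<gamma> < N \<or> k = \<kappa> + 1 \<and> \<gamma> = 0"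
  by (auto simp: slots_def N_def)

text \<open>The bound is strict: the address \<open>(\<kappa> + 1) * N\<close> is left to the class
  of profit \<open>2 * P0\<close>.\<close>

lemma index_less:
  assumes "b \<in> large"
  shows "index b < (\<kappa> + 1) * N"
proof -
  have "index b < (level b + 1) * N"
    using offset_bounds(2)[OF assms] by (simp add: index_def)
  also have "\<dots> \<le> (\<kappa> + 1) * N"
    using level_bounds(2)[OF assms] by (intro mult_right_mono) auto
  finally show ?thesis .
qed

text \<open>Quotient and remainder of a division by N are unique.\<close>

lemma mult_add_eq_iff:
  assumes "g < N" "g' < N"
  shows "k * N + g = k' * N + g' \<longleftrightarrow> k = k' \<and> g = (g' :: nat)"
proof
  assume eq: "k * N + g = k' * N + g'"
  have "(k * N + g) div N = k" "(k' * N + g') div N = k'"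
    using assms N_pos by auto
  then show "k = k' \<and> g = g'" using eq by auto
qed auto

text \<open>Reduces membership in a class to one address, the form in which the program sees it. For
  k = \<kappa> + 1 both sides are empty.\<close>

lemma profit_class_eq:
  assumes "(k, \<gamma>) \<in> slots \<kappa>"
  shows "profit_class n p \<kappa> \<epsilon> P0 k \<gamma> = {b \<in> large. index b = k * N + \<gamma>}"
proof (cases "k = \<kappa> + 1")
  case True
  then have \<gamma>: "\<gamma> = 0"
    using assms by (auto simp: mem_slots_iff)
  have "p b \<noteq> 2 * P0" if "b \<in> large" for b
    using profit_less[of b] that by (auto simp: large_items_def)
  moreover have "index b \<noteq> k * N + \<gamma>" if "b \<in> large" for b
    using index_less[OF that] True by auto
  ultimately show ?thesis
    using True \<gamma> by (auto simp: profit_class_def L_interval_def)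
next
  case False
  then have "k \<le> \<kappa>" "\<gamma> < N"
    using assms by (auto simp: mem_slots_iff)
  then show ?thesis
    using in_L_interval_iff offset_bounds(2) mult_add_eq_iff
    by (auto simp: profit_class_def index_def)
qed

lemma slots_index_le: "(k, \<gamma>) \<in> slots \<kappa> \<Longrightarrow> k * N + \<gamma> \<le> (\<kappa> + 1) * N"
proof -
  assume "(k, \<gamma>) \<in> slots \<kappa>"
  then consider "k = \<kappa> + 1" "\<gamma> = 0" | "k \<le> \<kappa>" "\<gamma> < N"
    by (auto simp: mem_slots_iff)
  then show ?thesis
  proof cases
    case 2
    then have "k * N + \<gamma> \<le> (k + 1) * N" by simp
    also have "\<dots> \<le> (\<kappa> + 1) * N" using 2 by (intro mult_right_mono) auto
    finally show ?thesis .
  qed simp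
qed

text \<open>Division by N with remainder recovers the pair, except for the last address, which
  belongs to (\<kappa> + 1, 0). Hence scanning all addresses visits precisely the slots.\<close>

lemma slots_index_surj:
  assumes "i \<le> (\<kappa> + 1) * N"
  shows "\<exists>k \<gamma>. (k, \<gamma>) \<in> slots \<kappa> \<and> i = k * N + \<gamma>"
proof (cases "i = (\<kappa> + 1) * N")
  case True
  then show ?thesis by (metis add_0_right mem_slots_iff)
next
  case False
  then have "i div N < \<kappa> + 1"
    using assms by (simp add: less_mult_imp_div_less)
  moreover have "i mod N < N"
    using N_pos by simp
  ultimately show ?thesis
    by (metis Suc_eq_plus1 div_mult_mod_eq less_Suc_eq_le mem_slots_iff)
qed

lemma card_slots: "finite (slots \<kappa>)" "card (slots \<kappa>) \<le> (\<kappa> + 1) * N + 1"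
proof -
  show "finite (slots \<kappa>)" by (simp add: slots_def)
  have "card (slots \<kappa>) \<le> card ({0..\<kappa>} \<times> {0..<2 ^ (\<kappa> + 1) * (\<kappa> + 1)}) + card {(\<kappa> + 1, 0::nat)}"
    unfolding slots_def by (rule card_Un_le)
  then show "card (slots \<kappa>) \<le> (\<kappa> + 1) * N + 1"
    by (simp add: N_def card_cartesian_product)
qed

lemma reduced_set_card:
  assumes "is_reduced_set n p s \<kappa> \<epsilon> P0 R"
  shows "finite R" "card R \<le> (\<kappa> + 1) * N + 1"
proof -
  obtain rep where "R \<subseteq> case_prod rep ` slots \<kappa>"
    using assms by (force simp: is_reduced_set_def)
  then show "finite R" "card R \<le> (\<kappa> + 1) * N + 1"
    using card_slots surj_card_le[of "slots \<kappa>" R "case_prod rep"]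
    by (auto intro: finite_subset)
qed

text \<open>Here log 2 (1/\<epsilon>) = \<kappa> - 1, and \<kappa> \<ge> 3 is exactly what \<kappa>
  + 1 \<le> 2 * (\<kappa> - 1) requires. Squaring yields 4 * 4 = 16. The second bound serves to
  absorb additive constants.\<close>

lemma slot_number_le:
  "real ((\<kappa> + 1) * N) \<le> 16 * (1 / \<epsilon> * (log 2 (1 / \<epsilon>))\<^sup>2)" "1 \<le> 1 / \<epsilon> * (log 2 (1 / \<epsilon>))\<^sup>2"
proof -
  have log: "log 2 (1 / \<epsilon>) = real \<kappa> - 1"
    using kappa_ge by (simp add: eps log_nat_power of_nat_diff)
  have "(real \<kappa> + 1)\<^sup>2 \<le> (2 * (real \<kappa> - 1))\<^sup>2"
    using kappa_ge by (intro power_mono) auto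
  then have "4 / \<epsilon> * (real \<kappa> + 1)\<^sup>2 \<le> 4 / \<epsilon> * (4 * (real \<kappa> - 1)\<^sup>2)"
    using eps_pos by (intro mult_left_mono) (simp_all only: power_mult_distrib, simp_all)
  moreover have "real ((\<kappa> + 1) * N) = 4 / \<epsilon> * (real \<kappa> + 1)\<^sup>2"
    by (simp only: of_nat_mult N_eq of_nat_add of_nat_1 power2_eq_square mult_ac)
  ultimately show "real ((\<kappa> + 1) * N) \<le> 16 * (1 / \<epsilon> * (log 2 (1 / \<epsilon>))\<^sup>2)"
    by (simp add: log)
  have "1 * 1 \<le> 1 / \<epsilon> * (log 2 (1 / \<epsilon>))\<^sup>2"
    unfolding log using eps_pos eps_le kappa_ge by (intro mult_mono) (auto simp: one_le_power)
  then show "1 \<le> 1 / \<epsilon> * (log 2 (1 / \<epsilon>))\<^sup>2" by simp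
qed


section \<open>Correctness and running time of the algorithm\<close>

abbreviation inp where "inp \<equiv> alg_input n p s \<kappa> \<epsilon> P0"

lemma inp_simps [simp]:
  "inp (''kappa'', 0) = Some (real \<kappa>)" "inp (''eps'', 0) = Some \<epsilon>" "inp (''P0'', 0) = Some P0"
  "inp (''n'', 0) = Some (real n)"
  "b < n \<Longrightarrow> inp (''p'', b) = Some (p b)" "b < n \<Longrightarrow> inp (''s'', b) = Some (s b)"
  by (simp_all add: alg_input_def)

text \<open>Addresses are computed in real arithmetic; these are the shapes in which they must be
  recognised as natural numbers.\<close>

lemma to_index_simps [simp]:
  "to_index 0 = Some 0"
  "to_index (real k * real m + real g) = Some (k * m + g)"
  "to_index (real k + 1) = Some (k + 1)"
  "to_index ((real k + 1) * real m) = Some ((k + 1) * m)"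
  using to_index_of_nat[of 0] to_index_of_nat[of "k * m + g"] to_index_of_nat[of "k + 1"]
    to_index_of_nat[of "(k + 1) * m"]
  by (simp_all add: algebra_simps)

section \<open>Memory layout and invariants of the memory\<close>

definition cells :: "(string \<times> nat) set" where
  "cells = {''N'', ''T'', ''K'', ''k'', ''g'', ''a'', ''j''} \<times> {0} \<union>
    {''pow''} \<times> {..\<kappa> + 1} \<union> {''slot''} \<times> {..(\<kappa> + 1) * N}"

text \<open>There are 7 scalars, \<kappa> + 2 powers and \<open>(\<kappa> + 1) * N + 1\<close>
  slots.\<close>

lemma card_cells: "finite cells" "card cells \<le> \<kappa> + (\<kappa> + 1) * N + 10"
proof -
  let ?A = "{''N'', ''T'', ''K'', ''k'', ''g'', ''a'', ''j''} \<times> {0::nat}"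
  let ?B = "{''pow''} \<times> {..\<kappa> + 1}" and ?C = "{''slot''} \<times> {..(\<kappa> + 1) * N}"
  show "finite cells" by (simp add: cells_def)
  have "card cells \<le> card ?A + card ?B + card ?C"
    unfolding cells_def using card_Un_le[of "?A \<union> ?B" ?C] card_Un_le[of ?A ?B] by linarith
  then show "card cells \<le> \<kappa> + (\<kappa> + 1) * N + 10"
    by (simp add: card_cartesian_product)
qed

text \<open>The inclusion in \<open>cells\<close> travels through all phases and yields the space
  bound at the end.\<close>

definition params_ok :: "memory \<Rightarrow> bool" where
  "params_ok \<mu> \<longleftrightarrow> \<mu> (''N'', 0) = Some (real N) \<and> \<mu> (''T'', 0) = Some T \<and>
    \<mu> (''K'', 0) = Some K \<and> dom \<mu> \<subseteq> cells"

definition powers_ok :: "memory \<Rightarrow> bool" where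
  "powers_ok \<mu> \<longleftrightarrow> params_ok \<mu> \<and> (\<forall>i\<le>\<kappa>. \<mu> (''pow'', i) = Some (2 ^ i))"

lemma params_ok_simps:
  assumes "params_ok \<mu>"
  shows "\<mu> (''N'', 0) = Some (real N)" "\<mu> (''T'', 0) = Some T" "\<mu> (''K'', 0) = Some K"
  using assms by (simp_all add: params_ok_def)

lemma params_ok_upd:
  assumes "params_ok \<mu>" "(x, i) \<in> cells" "x \<notin> {''N'', ''T'', ''K''}"
  shows "params_ok (\<mu>((x, i) \<mapsto> v))"
  using assms by (auto simp: params_ok_def)

lemma powers_ok_upd:
  assumes "powers_ok \<mu>" "(x, i) \<in> cells" "x \<notin> {''N'', ''T'', ''K'', ''pow''}"
  shows "powers_ok (\<mu>((x, i) \<mapsto> v))"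
  using assms by (auto simp: powers_ok_def params_ok_upd)

lemma powers_ok_simps:
  assumes "powers_ok \<mu>"
  shows "params_ok \<mu>" "i \<le> \<kappa> \<Longrightarrow> \<mu> (''pow'', i) = Some (2 ^ i)"
  using assms by (simp_all add: powers_ok_def)

lemma cells_simps [simp]:
  "(''k'', 0) \<in> cells" "(''g'', 0) \<in> cells" "(''a'', 0) \<in> cells" "(''j'', 0) \<in> cells"
  "(''pow'', i) \<in> cells \<longleftrightarrow> i \<le> \<kappa> + 1" "(''slot'', i) \<in> cells \<longleftrightarrow> i \<le> (\<kappa> + 1) * N"
  by (auto simp: cells_def)

section \<open>Initialization of parameters, powers and slots\<close>

lemma init_params_runs:
  "runs inp init_params (Map.empty, []) 40 (\<lambda>\<mu> out. params_ok \<mu> \<and> out = [])"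
  \<comment> \<open>\<open>N_eq\<close> identifies the computed real with a natural number, which
    lets it serve as a loop bound and in addresses.\<close>
  using eps_pos
  by (auto simp: runs_def init_params_def params_ok_def N_eq T_of_def K_of_def cells_def
      field_simps)

lemma init_powers_runs:
  assumes "params_ok \<mu>"
  shows "runs inp init_powers (\<mu>, []) (20 * (\<kappa> + 2)) (\<lambda>\<mu> out. powers_ok \<mu> \<and> out = [])"
  unfolding init_powers_def
proof (rule runs_Seq)
  let ?I = "\<lambda>m \<mu> out. params_ok \<mu> \<and> (\<forall>i\<le>m. \<mu> (''pow'', i) = Some (2 ^ i)) \<and> out = ([] :: real list)"
  show "runs inp (Put ''pow'' (Num 0) (Num 1)) (\<mu>, []) 3 (?I 0)"
    using assms by (intro runs_Put) (auto intro: params_ok_upd)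
  show "runs inp (For ''k'' (Par ''kappa'' \<^bold>+ Num 1)
        (Put ''pow'' (Var ''k'' \<^bold>+ Num 1) (Num 2 \<^bold>* Get ''pow'' (Var ''k''))))
      (\<mu>, out) (10 + 15 * (\<kappa> + 1)) (\<lambda>\<mu> out. powers_ok \<mu> \<and> out = [])"
    if "?I 0 \<mu> out" for \<mu> out
  \<comment> \<open>The assignment costs 10 units, rounded up to 13; with the counter this gives the
    15 per round. Later budgets are rounded likewise.\<close>
  proof (rule runs_For[where I = ?I and m = "\<kappa> + 1" and B = 13])
    fix i \<mu> out assume "i < \<kappa> + 1" "?I i \<mu> out"
    then show "runs inp (Put ''pow'' (Var ''k'' \<^bold>+ Num 1) (Num 2 \<^bold>* Get ''pow'' (Var ''k'')))
        (\<mu>((''k'', 0) \<mapsto> real i), out) 13 (?I (Suc i))"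
      by (intro runs_Put) (auto simp: le_Suc_eq intro!: params_ok_upd)
  qed (use that in \<open>auto simp: powers_ok_def\<close>)
qed simp

definition slots_empty :: "nat \<Rightarrow> memory \<Rightarrow> bool" where
  "slots_empty m \<mu> \<longleftrightarrow> (\<forall>i<m. \<mu> (''slot'', i) = Some (- 1))"

lemma init_slots_runs:
  assumes "powers_ok \<mu>"
  shows "runs inp init_slots (\<mu>, []) (20 * ((\<kappa> + 1) * N + \<kappa> + 2))
    (\<lambda>\<mu> out. powers_ok \<mu> \<and> slots_empty ((\<kappa> + 1) * N + 1) \<mu> \<and> out = [])"
  unfolding init_slots_def
proof (rule runs_Seq)
  let ?I = "\<lambda>m \<mu> out. powers_ok \<mu> \<and> slots_empty m \<mu> \<and> out = ([] :: real list)"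
  let ?inner = "For ''g'' (Var ''N'')
    (Put ''slot'' (slot_index (Var ''k'') (Var ''g'')) (Num (-1)))"
  show "runs inp (For ''k'' (Par ''kappa'' \<^bold>+ Num 1) ?inner) (\<mu>, [])
      (10 + (\<kappa> + 1) * (10 + 15 * N)) (?I ((\<kappa> + 1) * N))"
  proof (rule runs_For[where I = "\<lambda>k. ?I (k * N)" and m = "\<kappa> + 1" and B = "8 + 15 * N"])
    fix k \<mu> out assume k: "k < \<kappa> + 1" "?I (k * N) \<mu> out"
    \<comment> \<open>The inner invariant also records the outer counter, which the body reads to
      form the address.\<close>
    let ?J = "\<lambda>g \<mu> out. ?I (k * N + g) \<mu> out \<and> \<mu> (''k'', 0) = Some (real k)"
    show "runs inp ?inner (\<mu>((''k'', 0) \<mapsto> real k), out) (8 + 15 * N) (?I (Suc k * N))"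
    proof (rule runs_For[where I = ?J and m = N and B = 13])
      fix g \<mu> out assume g: "g < N" "?J g \<mu> out"
      have "k * N + g \<le> (\<kappa> + 1) * N"
        using k g by (intro slots_index_le) (auto simp: mem_slots_iff)
      moreover have "\<mu> (''N'', 0) = Some (real N)"
        using g params_ok_simps[OF powers_ok_simps(1)] by simp
      ultimately show "runs inp (Put ''slot'' (slot_index (Var ''k'') (Var ''g'')) (Num (-1)))
          (\<mu>((''g'', 0) \<mapsto> real g), out) 13 (?J (Suc g))"
        using g
        by (intro runs_Put) (auto simp: slots_empty_def less_Suc_eq intro!: powers_ok_upd)
    qed (use k params_ok_simps[OF powers_ok_simps(1)] in
        \<open>auto simp: slots_empty_def add.commute intro!: powers_ok_upd\<close>)
  qed (use assms in \<open>auto simp: slots_empty_def\<close>)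
  fix \<mu> out assume "?I ((\<kappa> + 1) * N) \<mu> out"
  moreover from this have "\<mu> (''N'', 0) = Some (real N)"
    using params_ok_simps[OF powers_ok_simps(1)] by simp
  ultimately show "runs inp (Put ''slot'' (slot_index (Par ''kappa'' \<^bold>+ Num 1) (Num 0)) (Num (-1)))
      (\<mu>, out) 12 (?I ((\<kappa> + 1) * N + 1))"
    by (intro runs_Put) (auto simp: slots_empty_def less_Suc_eq intro!: powers_ok_upd)
qed (simp add: algebra_simps)

section \<open>Filling the slots\<close>

definition slot_ok :: "nat \<Rightarrow> nat \<Rightarrow> real option \<Rightarrow> bool" where
  "slot_ok m i v \<longleftrightarrow>
    (if \<exists>b\<in>large. b < m \<and> index b = i
     then \<exists>r. v = Some (real r) \<and> is_arg_min s (\<lambda>b. b \<in> large \<and> b < m \<and> index b = i) r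
     else v = Some (- 1))"

definition slots_ok :: "nat \<Rightarrow> memory \<Rightarrow> bool" where
  "slots_ok m \<mu> \<longleftrightarrow> (\<forall>i\<le>(\<kappa> + 1) * N. slot_ok m i (\<mu> (''slot'', i)))"

text \<open>The items of address \<open>i\<close> below \<open>Suc a\<close> are those below
  \<open>a\<close>, since \<open>a\<close> is not among them.\<close>

lemma slot_ok_other:
  assumes "slot_ok a i v" "\<not> (a \<in> large \<and> index a = i)"
  shows "slot_ok (Suc a) i v"
proof -
  have "b \<in> large \<and> b < Suc a \<and> index b = i \<longleftrightarrow> b \<in> large \<and> b < a \<and> index b = i" for b
    using assms(2) by (auto simp: less_Suc_eq)
  then show ?thesis
    using assms(1) by (simp add: slot_ok_def Bex_def)
qed

lemma slot_ok_cases: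
  assumes "slot_ok m i v"
  obtains "v = Some (- 1)" "\<not> (\<exists>b\<in>large. b < m \<and> index b = i)"
  | r where "v = Some (real r)" "is_arg_min s (\<lambda>b. b \<in> large \<and> b < m \<and> index b = i) r"
  using assms by (auto simp: slot_ok_def split: if_splits)

lemma slot_ok_first:
  assumes "\<not> (\<exists>b\<in>large. b < a \<and> index b = i)" "a \<in> large" "index a = i"
  shows "slot_ok (Suc a) i (Some (real a))"
  using assms by (auto simp: slot_ok_def is_arg_min_linorder less_Suc_eq)

lemma slot_ok_next:
  assumes "is_arg_min s (\<lambda>b. b \<in> large \<and> b < a \<and> index b = i) r" "a \<in> large" "index a = i"
  shows "slot_ok (Suc a) i (Some (real (if s a < s r then a else r)))"
proof -
  have "is_arg_min s (\<lambda>b. b \<in> large \<and> b < Suc a \<and> index b = i) (if s a < s r then a else r)"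
    using assms by (intro is_arg_min_extend[OF assms(1)]) (auto simp: less_Suc_eq)
  moreover have ex: "\<exists>b\<in>large. b < Suc a \<and> index b = i"
    using assms(2,3) by auto
  ultimately show ?thesis
    unfolding slot_ok_def if_P[OF ex] by blast
qed

text \<open>Each item affects at most the cell \<open>index a\<close> and costs constant time. The
  budget 85 for a large item consists of 12 + 27 + 12 for the three assignments and 34 for the
  conditional store.\<close>

lemma fill_slots_runs:
  assumes "powers_ok \<mu>" "slots_empty ((\<kappa> + 1) * N + 1) \<mu>"
  shows "runs inp fill_slots (\<mu>, []) (100 * (n + 1))
    (\<lambda>\<mu> out. powers_ok \<mu> \<and> slots_ok n \<mu> \<and> out = [])"
  unfolding fill_slots_def
proof (rule runs_For[where I = "\<lambda>a \<mu> out. powers_ok \<mu> \<and> slots_ok a \<mu> \<and> out = []"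
      and m = n and B = 98], goal_cases)
  case (3 a \<mu> out)
  let ?\<mu> = "\<mu>((''a'', 0) \<mapsto> real a)"
  have a: "a < n" and out: "out = []" and ok: "powers_ok \<mu>" "slots_ok a \<mu>"
    using 3 by auto
  note ok_simps = powers_ok_simps[OF ok(1)] params_ok_simps[OF powers_ok_simps(1)[OF ok(1)]]
  have ok_a: "powers_ok ?\<mu>"
    using ok by (auto intro: powers_ok_upd)
  show ?case
  proof (rule runs_If[where r = "T \<le> p a" and t' = 85], goal_cases)
    case 2
    then have large: "a \<in> large"
      using a by (simp add: large_items_def)
    let ?k = "level a" and ?g = "offset a"
    let ?\<mu>1 = "?\<mu>((''k'', 0) \<mapsto> real ?k)"
    let ?\<mu>2 = "?\<mu>1((''g'', 0) \<mapsto> real ?g)"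
    let ?\<mu>3 = "?\<mu>2((''j'', 0) \<mapsto> real (index a))"
    note lb = level_bounds[OF large] and ob = offset_bounds[OF large]
    have "0 < p a / T"
      using 2 T_pos by simp
    have K_nz: "K \<noteq> 0"
      using T_pos N_pos by (simp add: K_eq)
    have index_le: "index a \<le> (\<kappa> + 1) * N"
      using index_less[OF large] by simp
    have ok3: "powers_ok ?\<mu>3"
      using ok by (auto intro!: powers_ok_upd)
    have old: "slot_ok a i (\<mu> (''slot'', i))" if "i \<le> (\<kappa> + 1) * N" for i
      using ok that by (simp add: slots_ok_def)
    \<comment> \<open>All other cells are unchanged and stay correct by
      \<open>slot_ok_other\<close>, so only the cell of \<open>a\<close> has to be checked.\<close>
    have post: "slots_ok (Suc a) \<mu>'" if "slot_ok (Suc a) (index a) (\<mu>' (''slot'', index a))"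
        "\<And>i. i \<noteq> index a \<Longrightarrow> \<mu>' (''slot'', i) = \<mu> (''slot'', i)" for \<mu>'
      unfolding slots_ok_def using that old slot_ok_other by metis
    show ?case
    proof (rule runs_Seq[where P = "\<lambda>\<mu>' out. \<mu>' = ?\<mu>1 \<and> out = []" and ?t1.0 = 12 and ?t2.0 = 73],
        goal_cases)
      case 1
      \<comment> \<open>\<open>lb(1)\<close> turns the computed floor into
        \<open>real (level a)\<close>, so \<open>k\<close> is a legal address afterwards.\<close>
      show ?case
        using a out \<open>0 < p a / T\<close> T_pos lb(1) ok_simps by (intro runs_Put) auto
    next
      case (2 \<mu>' out')
      show ?case
      proof (rule runs_Seq[where P = "\<lambda>\<mu>' out. \<mu>' = ?\<mu>2 \<and> out = []" and ?t1.0 = 27 and ?t2.0 = 46],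
          goal_cases)
        case 1
        \<comment> \<open>\<open>lb(2)\<close> keeps the look-up inside the table of powers, and
          \<open>K_nz\<close> excludes a division by zero.\<close>
        show ?case
          using 2 a K_nz lb(2) ob(1) ok_simps by (intro runs_Put) auto
      next
        case (2 \<mu>' out')
        show ?case
        proof (rule runs_Seq[where P = "\<lambda>\<mu>' out. \<mu>' = ?\<mu>3 \<and> out = []" and ?t1.0 = 12 and ?t2.0 = 34],
            goal_cases)
          case 1
          show ?case
            using 2 ok_simps by (intro runs_Put) (auto simp: index_def)
        next
          case (2 \<mu>' out')
          from old[OF index_le] show ?case
          proof (cases rule: slot_ok_cases)
            case 1
            \<comment> \<open>The slot contains -1, so the first disjunct holds. Lazy evaluation is
              essential: the second one would read the sizes at address -1.\<close>
            show ?thesis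
              using 2 1 index_le ok3 large
              by (intro runs_If[where r = True and t' = 8] runs_Put)
                (auto intro!: powers_ok_upd post slot_ok_first)
          next
            case (2 r)
            \<comment> \<open>The size of the stored item must be readable. As its index is
              nonnegative, the outcome of the disjunction is the comparison of sizes.\<close>
            then have "r < n"
              using a by (auto simp: is_arg_min_def)
            moreover have "slot_ok (Suc a) (index a) (Some (real (if s a < s r then a else r)))"
              using 2 large by (intro slot_ok_next) auto
            ultimately show ?thesis
              using \<open>\<mu>' = ?\<mu>3 \<and> out' = []\<close> 2 a index_le ok3
              by (intro runs_If[where r = "s a < s r" and t' = 8] runs_Put runs_Skip)
                (auto intro!: powers_ok_upd post)
          qed
        qed simp
      qed simp
    qed simp
  next
    case 3
    then have "a \<notin> large"
      by (simp add: large_items_def)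
    then show ?case
      using ok ok_a out by (intro runs_Skip) (auto simp: slots_ok_def slot_ok_other)
  qed (use a ok_simps in auto)
qed (use assms in \<open>auto simp: slots_ok_def slot_ok_def slots_empty_def\<close>)

section \<open>Output of the stored items\<close>

definition output_ok :: "nat \<Rightarrow> memory \<Rightarrow> real list \<Rightarrow> bool" where
  "output_ok m \<mu> out \<longleftrightarrow> params_ok \<mu> \<and> slots_ok n \<mu> \<and> length out \<le> m \<and>
    set out = {real r | r i. i < m \<and> \<mu> (''slot'', i) = Some (real r)}"

lemma output_ok_upd:
  assumes "output_ok m \<mu> out" "x \<in> {''k'', ''g''}"
  shows "output_ok m (\<mu>((x, 0) \<mapsto> v)) out"
  using assms by (auto simp: output_ok_def slots_ok_def intro: params_ok_upd)

text \<open>A cell contains either -1 or some \<open>real r\<close>, so the sign test separates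
  empty from occupied cells. Each call appends at most one value, which bounds the output space. The
  address expression is arbitrary to cover both the loop and the last slot.\<close>

lemma output_slot_runs:
  assumes "output_ok i \<mu> out" "i \<le> (\<kappa> + 1) * N"
    and "eval inp \<mu> j = Some v" "to_index v = Some i"
  shows "runs inp (output_slot j) (\<mu>, out) (2 * cost j + 10)
    (\<lambda>\<mu>' out'. \<mu>' = \<mu> \<and> output_ok (Suc i) \<mu> out')"
proof -
  have "slot_ok n i (\<mu> (''slot'', i))"
    using assms by (simp add: output_ok_def slots_ok_def)
  then show ?thesis
    unfolding output_slot_def
  proof (cases rule: slot_ok_cases)
    case 1
    then have "output_ok (Suc i) \<mu> out"
      using assms(1) by (auto simp: output_ok_def less_Suc_eq)
    then show "runs inp (If (Num 0 \<^bold>\<le> Get ''slot'' j) (Output (Get ''slot'' j)) Skip) (\<mu>, out)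
        (2 * cost j + 10) (\<lambda>\<mu>' out'. \<mu>' = \<mu> \<and> output_ok (Suc i) \<mu> out')"
      using 1 assms by (intro runs_If[where r = False and t' = 2] runs_Skip) auto
  next
    case (2 r)
    then have "output_ok (Suc i) \<mu> (out @ [real r])"
      using assms(1) by (auto simp: output_ok_def less_Suc_eq)
    then show "runs inp (If (Num 0 \<^bold>\<le> Get ''slot'' j) (Output (Get ''slot'' j)) Skip) (\<mu>, out)
        (2 * cost j + 10) (\<lambda>\<mu>' out'. \<mu>' = \<mu> \<and> output_ok (Suc i) \<mu> out')"
      using 2 assms by (intro runs_If[where r = True and t' = "cost j + 2"] runs_Output) auto
  qed
qed

lemma output_slots_runs:
  assumes "powers_ok \<mu>" "slots_ok n \<mu>"
  shows "runs inp output_slots (\<mu>, []) (50 * ((\<kappa> + 1) * N + \<kappa> + 2))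
    (output_ok ((\<kappa> + 1) * N + 1))"
  unfolding output_slots_def
proof (rule runs_Seq)
  let ?body = "output_slot (slot_index (Var ''k'') (Var ''g''))"
  let ?inner = "For ''g'' (Var ''N'') ?body"
  show "runs inp (For ''k'' (Par ''kappa'' \<^bold>+ Num 1) ?inner) (\<mu>, [])
      (10 + (\<kappa> + 1) * (10 + 42 * N)) (output_ok ((\<kappa> + 1) * N))"
  proof (rule runs_For[where I = "\<lambda>k. output_ok (k * N)" and m = "\<kappa> + 1" and B = "8 + 42 * N"])
    fix k \<mu> out assume k: "k < \<kappa> + 1" "output_ok (k * N) \<mu> out"
    \<comment> \<open>As in the initialization, \<open>k * N + g\<close> counts the cells already
      scanned.\<close>
    let ?J = "\<lambda>g \<mu> out. output_ok (k * N + g) \<mu> out \<and> \<mu> (''k'', 0) = Some (real k)"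
    show "runs inp ?inner (\<mu>((''k'', 0) \<mapsto> real k), out) (8 + 42 * N) (output_ok (Suc k * N))"
    proof (rule runs_For[where I = ?J and m = N and B = 40])
      fix g \<mu> out assume g: "g < N" "?J g \<mu> out"
      let ?\<mu> = "\<mu>((''g'', 0) \<mapsto> real g)"
      have "k * N + g \<le> (\<kappa> + 1) * N"
        using k g by (intro slots_index_le) (auto simp: mem_slots_iff)
      moreover have "output_ok (k * N + g) ?\<mu> out"
        using g by (auto intro: output_ok_upd)
      moreover have "eval inp ?\<mu> (slot_index (Var ''k'') (Var ''g'')) =
          Some (real k * real N + real g)"
        using g by (auto simp: output_ok_def params_ok_simps)
      ultimately show "runs inp ?body (?\<mu>, out) 40 (?J (Suc g))"
        using g by (intro runs_mono[OF output_slot_runs]) auto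
    qed (use k in \<open>auto simp: add.commute output_ok_upd, simp add: output_ok_def params_ok_simps\<close>)
  qed (use assms in \<open>auto simp: output_ok_def powers_ok_simps\<close>)
  fix \<mu> out assume *: "output_ok ((\<kappa> + 1) * N) \<mu> out"
  then have "eval inp \<mu> (slot_index (Par ''kappa'' \<^bold>+ Num 1) (Num 0)) = Some ((real \<kappa> + 1) * real N)"
    by (auto simp: output_ok_def params_ok_simps)
  then show "runs inp (output_slot (slot_index (Par ''kappa'' \<^bold>+ Num 1) (Num 0)))
      (\<mu>, out) 32 (output_ok ((\<kappa> + 1) * N + 1))"
    using * by (intro runs_mono[OF output_slot_runs]) auto
qed (simp add: algebra_simps)

section \<open>Composition of the phases and correctness of the output\<close>

lemma reduction_alg_runs:
  "runs inp reduction_alg (Map.empty, []) (100 * n + 90 * ((\<kappa> + 1) * N + \<kappa> + 2) + 140)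
    (output_ok ((\<kappa> + 1) * N + 1))"
  unfolding reduction_alg_def
  \<comment> \<open>The constant 140 is 40 + 100 from the parameters and the item loop; the factor
    90 is 20 + 20 + 50 from powers, slots and output.\<close>
  by (rule runs_Seq[OF init_params_runs], elim conjE, hypsubst,
      rule runs_Seq[OF init_powers_runs], assumption, elim conjE, hypsubst,
      rule runs_Seq[OF init_slots_runs], assumption, elim conjE, hypsubst,
      rule runs_Seq[OF fill_slots_runs], assumption, assumption, elim conjE, hypsubst,
      rule output_slots_runs, assumption, assumption, (rule order_refl)+)
    (simp add: algebra_simps)

text \<open>The final memory itself supplies the choice of representatives, so ties are resolved as
  the run resolved them.\<close>

lemma output_reduced:
  assumes "output_ok ((\<kappa> + 1) * N + 1) \<mu> out"
  shows "\<exists>R. is_reduced_set n p s \<kappa> \<epsilon> P0 R \<and> set out = real ` R"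
proof -
  let ?class = "profit_class n p \<kappa> \<epsilon> P0"
  let ?occ = "\<lambda>k \<gamma> r. \<mu> (''slot'', k * N + \<gamma>) = Some (real r)"
  \<comment> \<open>The description is unique for an occupied slot because \<open>real\<close> is
    injective; for an empty slot its value does not enter \<open>R\<close>.\<close>
  define rep where "rep = (\<lambda>k \<gamma>. THE r. ?occ k \<gamma> r)"
  define R where "R = {rep k \<gamma> | k \<gamma>. (k, \<gamma>) \<in> slots \<kappa> \<and> ?class k \<gamma> \<noteq> {}}"
  have rep_eq: "rep k \<gamma> = r" if "?occ k \<gamma> r" for k \<gamma> r
    using that by (auto simp: rep_def)
  have slot: "(?class k \<gamma> = {} \<longrightarrow> (\<forall>r. \<not> ?occ k \<gamma> r)) \<and>
      (?class k \<gamma> \<noteq> {} \<longrightarrow> ?occ k \<gamma> (rep k \<gamma>) \<and> is_arg_min s (\<lambda>b. b \<in> ?class k \<gamma>) (rep k \<gamma>))"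
    if kg: "(k, \<gamma>) \<in> slots \<kappa>" for k \<gamma>
  proof -
    have class_iff: "b \<in> large \<and> b < n \<and> index b = k * N + \<gamma> \<longleftrightarrow> b \<in> ?class k \<gamma>" for b
      using profit_class_eq[OF kg] by (auto simp: large_items_def)
    have "slot_ok n (k * N + \<gamma>) (\<mu> (''slot'', k * N + \<gamma>))"
      using assms slots_index_le[OF kg] by (simp add: output_ok_def slots_ok_def)
    then show ?thesis
    proof (cases rule: slot_ok_cases)
      case 1
      then have "?class k \<gamma> = {}"
        using class_iff by blast
      then show ?thesis
        using 1 by auto
    next
      case (2 r)
      then have "is_arg_min s (\<lambda>b. b \<in> ?class k \<gamma>) r"
        by (simp only: class_iff)
      moreover from this have "r \<in> ?class k \<gamma>"
        by (simp add: is_arg_min_def)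
      ultimately show ?thesis
        using 2 rep_eq by auto
    qed
  qed
  have "is_reduced_set n p s \<kappa> \<epsilon> P0 R"
    unfolding is_reduced_set_def using slot by (intro exI[of _ rep]) (auto simp: R_def)
  moreover have "set out = real ` R"
  proof (rule set_eqI)
    fix v
    have "v \<in> set out \<longleftrightarrow>
        (\<exists>r i. v = real r \<and> i \<le> (\<kappa> + 1) * N \<and> \<mu> (''slot'', i) = Some (real r))"
      using assms by (auto simp: output_ok_def less_Suc_eq_le)
    \<comment> \<open>Passes from addresses to slots.\<close>
    also have "\<dots> \<longleftrightarrow> (\<exists>r k \<gamma>. v = real r \<and> (k, \<gamma>) \<in> slots \<kappa> \<and> ?occ k \<gamma> r)"
      using slots_index_surj slots_index_le by metis
    also have "\<dots> \<longleftrightarrow> v \<in> real ` R"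
    proof
      assume "\<exists>r k \<gamma>. v = real r \<and> (k, \<gamma>) \<in> slots \<kappa> \<and> ?occ k \<gamma> r"
      then obtain r k \<gamma> where v: "v = real r" and kg: "(k, \<gamma>) \<in> slots \<kappa>" "?occ k \<gamma> r"
        by blast
      then have "?class k \<gamma> \<noteq> {}"
        using slot by blast
      then show "v \<in> real ` R"
        using v kg rep_eq[OF kg(2)] by (auto simp: R_def)
    next
      assume "v \<in> real ` R"
      then obtain k \<gamma> where "v = real (rep k \<gamma>)" "(k, \<gamma>) \<in> slots \<kappa>" "?class k \<gamma> \<noteq> {}"
        by (auto simp: R_def)
      then show "\<exists>r k \<gamma>. v = real r \<and> (k, \<gamma>) \<in> slots \<kappa> \<and> ?occ k \<gamma> r"
        using slot by blast
    qed
    finally show "v \<in> set out \<longleftrightarrow> v \<in> real ` R" .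
  qed
  ultimately show ?thesis by blast
qed

end


section \<open>One constant for the cardinality, time and space bounds\<close>

theorem theorem4:
  "\<exists>C :: real. \<forall>(n :: nat) (p :: nat \<Rightarrow> real) (s :: nat \<Rightarrow> real) (\<kappa> :: nat) (\<epsilon> :: real) (a_me :: nat) (P0 :: real).
     ukp_instance n p s \<longrightarrow> \<epsilon> = 1 / 2 ^ (\<kappa> - 1) \<longrightarrow> \<epsilon> \<le> 1 / 4 \<longrightarrow>
     most_efficient n p s a_me \<longrightarrow> P0 = P0_of p s a_me \<longrightarrow>
       (\<forall>R. is_reduced_set n p s \<kappa> \<epsilon> P0 R \<longrightarrow>
          finite R \<and> real (card R) \<le> C * (1 / \<epsilon> * (log 2 (1 / \<epsilon>))\<^sup>2)) \<and>
       (\<exists>\<sigma> t R. exec (alg_input n p s \<kappa> \<epsilon> P0) reduction_alg (Map.empty, []) = Some (\<sigma>, t) \<and>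
          is_reduced_set n p s \<kappa> \<epsilon> P0 R \<and> set (snd \<sigma>) = real ` R \<and>
          real t \<le> C * (real n + 1 / \<epsilon> * (log 2 (1 / \<epsilon>))\<^sup>2) \<and>
          real (space \<sigma>) \<le> C * (1 / \<epsilon> * (log 2 (1 / \<epsilon>))\<^sup>2))"
proof (intro exI[of _ 5000] allI impI)
  fix n \<kappa> a_me :: nat and p s :: "nat \<Rightarrow> real" and \<epsilon> P0 :: real
  assume "ukp_instance n p s" "\<epsilon> = 1 / 2 ^ (\<kappa> - 1)" "\<epsilon> \<le> 1 / 4" "most_efficient n p s a_me"
    "P0 = P0_of p s a_me"
  then interpret knapsack n p s \<kappa> \<epsilon> a_me P0
    by unfold_locales
  \<comment> \<open>With M \<le> 16 * Q and 1 \<le> Q, the cardinality is at most 17 * Q, the time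
    at most 100 * n + 3200 * Q and the space at most 59 * Q; 5000 covers all three.\<close>
  define Q where "Q = 1 / \<epsilon> * (log 2 (1 / \<epsilon>))\<^sup>2"
  define M where "M = (\<kappa> + 1) * N"
  have M: "real M \<le> 16 * Q" "1 \<le> Q"
    unfolding M_def Q_def by (fact slot_number_le)+
  have kappa: "\<kappa> \<le> M"
    unfolding M_def using N_pos by (metis add_leD1 mult_le_mono2 mult.right_neutral Suc_leI One_nat_def)
  obtain \<mu> out t where exec: "exec inp reduction_alg (Map.empty, []) = Some ((\<mu>, out), t)"
    and t: "t \<le> 100 * n + 90 * (M + \<kappa> + 2) + 140" and out: "output_ok (M + 1) \<mu> out"
    using reduction_alg_runs by (auto simp: runs_def M_def)
  obtain R where R: "is_reduced_set n p s \<kappa> \<epsilon> P0 R" "set out = real ` R"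
    using output_reduced out M_def by metis
  have "card (dom \<mu>) \<le> card cells"
    using out card_cells(1) by (intro card_mono) (auto simp: output_ok_def params_ok_def)
  \<comment> \<open>At most \<kappa> + M + 10 memory cells and M + 1 output values.\<close>
  then have space: "space (\<mu>, out) \<le> \<kappa> + 2 * M + 11"
    using card_cells(2) out by (simp add: space_def output_ok_def M_def)
  have "real t \<le> real (100 * n + 180 * M + 320)"
    using t kappa by (intro of_nat_mono) simp
  then have time: "real t \<le> 5000 * (real n + Q)"
    using M by simp
  have "real (space (\<mu>, out)) \<le> real (3 * M + 11)"
    using space kappa by (intro of_nat_mono) simp
  then have space': "real (space (\<mu>, out)) \<le> 5000 * Q"
    using M by simp
  have "finite R \<and> real (card R) \<le> 5000 * Q" if "is_reduced_set n p s \<kappa> \<epsilon> P0 R" for R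
  proof -
    have "real (card R) \<le> real (M + 1)"
      using reduced_set_card(2)[OF that] unfolding M_def by (intro of_nat_mono)
    then show ?thesis
      using reduced_set_card(1)[OF that] M by simp
  qed
  then show "(\<forall>R. is_reduced_set n p s \<kappa> \<epsilon> P0 R \<longrightarrow>
          finite R \<and> real (card R) \<le> 5000 * (1 / \<epsilon> * (log 2 (1 / \<epsilon>))\<^sup>2)) \<and>
       (\<exists>\<sigma> t R. exec inp reduction_alg (Map.empty, []) = Some (\<sigma>, t) \<and>
          is_reduced_set n p s \<kappa> \<epsilon> P0 R \<and> set (snd \<sigma>) = real ` R \<and>
          real t \<le> 5000 * (real n + 1 / \<epsilon> * (log 2 (1 / \<epsilon>))\<^sup>2) \<and>
          real (space \<sigma>) \<le> 5000 * (1 / \<epsilon> * (log 2 (1 / \<epsilon>))\<^sup>2))"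
    unfolding Q_def[symmetric] using exec R time space'
    by (intro conjI exI[of _ "(\<mu>, out)"] exI[of _ t] exI[of _ R]) simp_all
qed

end
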